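(* For every integer $k\geq 0$ there exists a connected non-bipartite König-Egerváry graph $H_k$ of order $2k+8$ such that: (1) $h(H_k)>\frac{n(H_k)}{2}=\alpha(H_k)$; (2) each $S\in\Omega(H_k)$ is a maximal annihilating set.
   Context: Graphs are finite, undirected, without loops or multiple edges. $n(G)=|V(G)|$ is the order and $m(G)=|E(G)|$. $\alpha(G)$ is the maximum size of an independent set, $\mu(G)$ the maximum size of a matching, and $\Omega(G)$ the family of all independent sets of size $\alpha(G)$. $G$ is a König-Egerváry graph if $\alpha(G)+\mu(G)=|V(G)|$. If $d_1\leq d_2\leq\cdots\leq d_n$ is the degree sequence of $G$, the annihilation number $h(G)$ is the largest integer $k$ (with $0\le k\le n$) such that $\sum_{i=1}^{k} d_i\leq m(G)$. For $A\subseteq V(G)$ let $\deg(A)=\sum_{v\in A}\deg(v)$. A set $A\subseteq V(G)$ is an annihilating set if $\deg(A)\leq m(G)$; an annihilating set $A$ is maximal if $\deg(A\cup\{v\})>m(G)$ for every $v\in V(G)-A$. *)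

theory Defs
  imports Complex_Main "HOL-Library.Multiset"
begin

text \<open>
  A simple graph is a pair of a finite vertex set and a set of edges, each edge being a
  two-element set of vertices (so loops and multiple edges cannot occur).
\<close>

record 'a ugraph =
  verts :: "'a set"
  edges :: "'a set set"

definition simple_graph :: "'a ugraph \<Rightarrow> bool" where
  "simple_graph G \<longleftrightarrow> finite (verts G) \<and> (\<forall>e\<in>edges G. e \<subseteq> verts G \<and> card e = 2)"

definition order_of :: "'a ugraph \<Rightarrow> nat" where
  "order_of G = card (verts G)"

definition size_of :: "'a ugraph \<Rightarrow> nat" where
  "size_of G = card (edges G)"

definition connected_graph :: "'a ugraph \<Rightarrow> bool" where
  "connected_graph G \<longleftrightarrow>
     verts G \<noteq> {} \<and> (\<forall>u\<in>verts G. \<forall>v\<in>verts G. (u, v) \<in> {(x, y). {x, y} \<in> edges G}\<^sup>*)"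

definition bipartite :: "'a ugraph \<Rightarrow> bool" where
  "bipartite G \<longleftrightarrow> (\<exists>A B. A \<union> B = verts G \<and> A \<inter> B = {} \<and>
     (\<forall>e\<in>edges G. \<exists>a\<in>A. \<exists>b\<in>B. e = {a, b}))"

definition independent_set :: "'a ugraph \<Rightarrow> 'a set \<Rightarrow> bool" where
  "independent_set G S \<longleftrightarrow> S \<subseteq> verts G \<and> (\<forall>u\<in>S. \<forall>v\<in>S. {u, v} \<notin> edges G)"

definition independence_number :: "'a ugraph \<Rightarrow> nat" where
  "independence_number G = Max (card ` {S. independent_set G S})"

definition maximum_independent_sets :: "'a ugraph \<Rightarrow> 'a set set" where
  "maximum_independent_sets G =
     {S. independent_set G S \<and> card S = independence_number G}"

definition matching :: "'a ugraph \<Rightarrow> 'a set set \<Rightarrow> bool" where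
  "matching G M \<longleftrightarrow> M \<subseteq> edges G \<and> pairwise disjnt M"

definition matching_number :: "'a ugraph \<Rightarrow> nat" where
  "matching_number G = Max (card ` {M. matching G M})"

definition konig_egervary :: "'a ugraph \<Rightarrow> bool" where
  "konig_egervary G \<longleftrightarrow> independence_number G + matching_number G = order_of G"

definition vdeg :: "'a ugraph \<Rightarrow> 'a \<Rightarrow> nat" where
  "vdeg G v = card {e \<in> edges G. v \<in> e}"

definition set_deg :: "'a ugraph \<Rightarrow> 'a set \<Rightarrow> nat" where
  "set_deg G A = (\<Sum>v\<in>A. vdeg G v)"

definition degree_sequence :: "'a ugraph \<Rightarrow> nat list" where
  "degree_sequence G = sorted_list_of_multiset (image_mset (vdeg G) (mset_set (verts G)))"

text \<open>
  The list is indexed from 0, so the sum of the first \<open>k\<close> degrees runs over \<open>i < k\<close>.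
\<close>

definition annihilation_number :: "'a ugraph \<Rightarrow> nat" where
  "annihilation_number G =
     Max {k. k \<le> order_of G \<and> (\<Sum>i<k. degree_sequence G ! i) \<le> size_of G}"

definition annihilating_set :: "'a ugraph \<Rightarrow> 'a set \<Rightarrow> bool" where
  "annihilating_set G A \<longleftrightarrow> A \<subseteq> verts G \<and> set_deg G A \<le> size_of G"

definition maximal_annihilating_set :: "'a ugraph \<Rightarrow> 'a set \<Rightarrow> bool" where
  "maximal_annihilating_set G A \<longleftrightarrow>
     annihilating_set G A \<and> (\<forall>v\<in>verts G - A. set_deg G (A \<union> {v}) > size_of G)"

end

theory Submission
  imports Defs
begin

text \<open>
  Put \<open>n = k + 4\<close> and take \<open>2 * n\<close> vertices split into halves \<open>A = {a\<^sub>0, \<dots>}\<close> and \<open>B = {b\<^sub>0, \<dots>}\<close>.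
  Join every \<open>a\<^sub>i\<close> to \<open>b\<^sub>i\<close>, join both \<open>a\<^sub>0\<close> and \<open>a\<^sub>1\<close> to all of \<open>B\<close>, and add the single edge
  \<open>b\<^sub>0 b\<^sub>1\<close>. The edges \<open>a\<^sub>i b\<^sub>i\<close> form a perfect matching, and the triangle \<open>a\<^sub>0 b\<^sub>0 b\<^sub>1\<close> rules out
  bipartiteness.

  The two hubs and the extra edge make \<open>A\<close> the only maximum independent set: an independent
  set that meets \<open>B\<close> loses both hubs, contains at most one vertex of each other matched pair,
  and at most one of \<open>b\<^sub>0\<close>, \<open>b\<^sub>1\<close>, so it has at most \<open>n - 1\<close> elements
  (\<open>independent_set_hub_graph\<close>).

  Since \<open>A\<close> is independent, its degree sum counts the edges that meet it
  (\<open>set_deg_independent\<close>), which is every edge but \<open>b\<^sub>0 b\<^sub>1\<close>. The slack is thus one, less than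
  the degree of any vertex of \<open>B\<close>, so \<open>A\<close> is a maximal annihilating set. It is far from
  the cheapest choice of \<open>n\<close> vertices, though, because it contains the two hubs: the \<open>n - 2\<close>
  leaves together with three vertices of degree three have degree sum \<open>n + 7\<close>, which is at most
  the number \<open>3 * n - 1\<close> of edges exactly when \<open>n \<ge> 4\<close>. These are \<open>n + 1\<close> vertices, so the
  annihilation number exceeds \<open>n\<close> (\<open>card_le_annihilation_number\<close>).
\<close>

section \<open>Annihilating, independent and matching sets in arbitrary graphs\<close>

lemma sum_sorted_prefix_le_submultiset:
  fixes xs :: "nat list"
  assumes "sorted xs" "M \<subseteq># mset xs"
  shows "(\<Sum>i<size M. xs ! i) \<le> sum_mset M"
  using assms
proof (induction xs arbitrary: M)
  case Nil
  then show ?case by simp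
next
  case (Cons x ys)
  show ?case
  proof (cases "x \<in># M")
    case True
    then obtain M' where M: "M = add_mset x M'"
      by (meson multi_member_split)
    then have "(\<Sum>i<size M'. ys ! i) \<le> sum_mset M'"
      using Cons by simp
    then show ?thesis
      unfolding M by (simp add: sum.lessThan_Suc_shift del: sum.lessThan_Suc)
  next
    case False
    then have sub: "M \<subseteq># mset ys"
      using Cons.prems(2) False
      by (metis add_mset_add_single diff_single_trivial mset.simps(2) subset_eq_diff_conv)
    then have len: "size M \<le> length ys"
      by (metis size_mset size_mset_mono)
    \<comment> \<open>Prepending a smallest element can only decrease the entry at each position.\<close>
    have "(x # ys) ! i \<le> ys ! i" if "i < size M" for i
      using sorted_nth_mono[OF Cons.prems(1), of i "Suc i"] that len by simp
    then have "(\<Sum>i<size M. (x # ys) ! i) \<le> (\<Sum>i<size M. ys ! i)"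
      by (intro sum_mono) simp
    also have "\<dots> \<le> sum_mset M"
      using Cons sub by simp
    finally show ?thesis .
  qed
qed

text \<open>
  This bounds the annihilation number from below without computing the sorted degree
  sequence: its first entries are the cheapest choice of that many vertices.
\<close>

lemma card_le_annihilation_number:
  assumes fin: "finite (verts G)" and ann: "annihilating_set G D"
  shows "card D \<le> annihilation_number G"
proof -
  have D: "D \<subseteq> verts G" "set_deg G D \<le> size_of G"
    using ann by (auto simp: annihilating_set_def)
  let ?M = "image_mset (vdeg G) (mset_set D)"
  have "?M \<subseteq># mset (degree_sequence G)"
    unfolding degree_sequence_def
    using D fin by (simp add: image_mset_subseteq_mono subset_imp_msubset_mset_set)
  moreover have "sorted (degree_sequence G)"
    by (simp add: degree_sequence_def)
  ultimately have "(\<Sum>i<size ?M. degree_sequence G ! i) \<le> sum_mset ?M"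
    by (rule sum_sorted_prefix_le_submultiset[rotated])
  then have "(\<Sum>i<card D. degree_sequence G ! i) \<le> set_deg G D"
    by (simp add: set_deg_def sum_unfold_sum_mset)
  then have "card D \<in> {k. k \<le> order_of G \<and> (\<Sum>i<k. degree_sequence G ! i) \<le> size_of G}"
    using D card_mono[OF fin D(1)] by (simp add: order_of_def)
  then show ?thesis
    unfolding annihilation_number_def by (intro Max_ge) auto
qed

lemma finite_edges:
  assumes "simple_graph G"
  shows "finite (edges G)"
  using assms by (auto simp: simple_graph_def intro: finite_subset[of _ "Pow (verts G)"])

text \<open>No edge has both endpoints in an independent set, so summing degrees counts no edge twice.\<close>

lemma set_deg_independent:
  assumes G: "simple_graph G" and ind: "independent_set G S"
  shows "set_deg G S = card {e \<in> edges G. e \<inter> S \<noteq> {}}"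
proof -
  have finS: "finite S"
    using G ind by (auto simp: simple_graph_def independent_set_def intro: finite_subset)
  have "{e \<in> edges G. u \<in> e} \<inter> {e \<in> edges G. v \<in> e} = {}"
    if "u \<in> S" "v \<in> S" "u \<noteq> v" for u v
  proof (rule ccontr)
    assume "\<not> ?thesis"
    then obtain e where e: "e \<in> edges G" "u \<in> e" "v \<in> e" by blast
    then have "card e = 2" using G by (auto simp: simple_graph_def)
    then have "e = {u, v}" using e that by (auto simp: card_2_iff)
    then show False using e that ind by (auto simp: independent_set_def)
  qed
  then have "set_deg G S = card (\<Union>v\<in>S. {e \<in> edges G. v \<in> e})"
    unfolding set_deg_def vdeg_def
    using finS finite_edges[OF G] by (subst card_UN_disjoint) auto
  also have "(\<Union>v\<in>S. {e \<in> edges G. v \<in> e}) = {e \<in> edges G. e \<inter> S \<noteq> {}}"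
    by blast
  finally show ?thesis .
qed

lemma card_matching_le:
  assumes G: "simple_graph G" and M: "matching G M"
  shows "2 * card M \<le> order_of G"
proof -
  have two: "card e = 2" "finite e" if "e \<in> M" for e
    using that G M by (auto simp: simple_graph_def matching_def intro: finite_subset)
  have "card (\<Union>M) = 2 * card M"
    using M two by (subst card_Union_disjoint) (auto simp: matching_def)
  moreover have "\<Union>M \<subseteq> verts G"
    using G M by (auto simp: simple_graph_def matching_def)
  ultimately show ?thesis
    using G by (metis card_mono order_of_def simple_graph_def)
qed

lemma matching_number_perfect:
  assumes G: "simple_graph G" and M: "matching G M" and card: "2 * card M = order_of G"
  shows "matching_number G = card M"
  unfolding matching_number_def
proof (rule Max_eqI)
  have "{M. matching G M} \<subseteq> Pow (edges G)" by (auto simp: matching_def)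
  then show "finite (card ` {M. matching G M})"
    using finite_edges[OF G] by (meson finite_Pow_iff finite_imageI finite_subset)
  show "c \<le> card M" if "c \<in> card ` {M. matching G M}" for c
    using that card_matching_le[OF G] card by fastforce
qed (use M in auto)

lemma unique_maximum_independent_set:
  assumes G: "simple_graph G" and A: "independent_set G A"
    and less: "\<And>S. independent_set G S \<Longrightarrow> S \<noteq> A \<Longrightarrow> card S < card A"
  shows "independence_number G = card A" "maximum_independent_sets G = {A}"
proof -
  show *: "independence_number G = card A"
    unfolding independence_number_def
  proof (rule Max_eqI)
    have "{S. independent_set G S} \<subseteq> Pow (verts G)" by (auto simp: independent_set_def)
    then show "finite (card ` {S. independent_set G S})"
      using G by (meson finite_Pow_iff finite_imageI finite_subset simple_graph_def)
    show "c \<le> card A" if "c \<in> card ` {S. independent_set G S}" for c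
      using that less by (auto simp: less_imp_le) (metis less_imp_le order_refl)
  qed (use A in auto)
  show "maximum_independent_sets G = {A}"
    unfolding maximum_independent_sets_def * using A less by fastforce
qed

section \<open>A balanced graph with two hubs and one extra edge\<close>

text \<open>
  Vertex \<open>i < n\<close> stands for \<open>a\<^sub>i\<close> and \<open>n + j\<close> for \<open>b\<^sub>j\<close>. The hubs are \<open>0\<close> and \<open>1\<close>; the pairs
  \<open>(i, i)\<close> with \<open>i < 2\<close> are already contained in the first component.
\<close>

definition hub_pairs :: "nat \<Rightarrow> (nat \<times> nat) set" where
  "hub_pairs n = {0, 1} \<times> {..<n} \<union> (\<lambda>i. (i, i)) ` {2..<n}"

definition hub_graph :: "nat \<Rightarrow> nat ugraph" where
  "hub_graph n = \<lparr>verts = {..<2 * n},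
     edges = insert {n, n + 1} ((\<lambda>(i, j). {i, n + j}) ` hub_pairs n)\<rparr>"

lemma hub_pairs_iff: "(i, j) \<in> hub_pairs n \<longleftrightarrow> i < 2 \<and> j < n \<or> 2 \<le> i \<and> i < n \<and> j = i"
  by (auto simp: hub_pairs_def)

lemma verts_hub_graph [simp]: "verts (hub_graph n) = {..<2 * n}"
  by (simp add: hub_graph_def)

lemma order_of_hub_graph: "order_of (hub_graph n) = 2 * n"
  by (simp add: order_of_def)

lemma hub_graph_edge_cases:
  assumes "e \<in> edges (hub_graph n)"
  obtains "e = {n, n + 1}"
    | i j where "e = {i, n + j}" "i < 2" "j < n"
    | i where "e = {i, n + i}" "2 \<le> i" "i < n"
  using assms by (auto simp: hub_graph_def hub_pairs_iff)

lemma hub_graph_edges: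
  shows extra_edge: "{n, n + 1} \<in> edges (hub_graph n)"
    and hub_edge: "i < 2 \<Longrightarrow> j < n \<Longrightarrow> {i, n + j} \<in> edges (hub_graph n)"
    and matching_edge: "i < n \<Longrightarrow> {i, n + i} \<in> edges (hub_graph n)"
  by (auto simp: hub_graph_def hub_pairs_iff intro!: image_eqI[of _ _ "(i, j)" for j])

lemma simple_hub_graph:
  assumes "n \<ge> 2"
  shows "simple_graph (hub_graph n)"
  using assms by (auto simp: simple_graph_def elim!: hub_graph_edge_cases)

text \<open>
  The hub \<open>0\<close> sees all of \<open>B\<close>, and every vertex of \<open>A\<close> has a neighbour in \<open>B\<close>; so everything is
  within distance two of \<open>0\<close>.
\<close>

lemma connected_hub_graph:
  assumes "n \<ge> 2"
  shows "connected_graph (hub_graph n)"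
proof -
  let ?R = "{(x, y). {x, y} \<in> edges (hub_graph n)}"
  have symR: "(y, x) \<in> ?R" if "(x, y) \<in> ?R" for x y
    using that by (simp add: insert_commute)
  have B: "(0, n + j) \<in> ?R\<^sup>*" if "j < n" for j
    using hub_edge[of 0 j n] that by auto
  have A: "(0, i) \<in> ?R\<^sup>*" if "i < n" for i
  proof -
    have "(i, n + i) \<in> ?R" using matching_edge[of i n] that by simp
    then show ?thesis using B[OF that] symR by (meson rtrancl.rtrancl_into_rtrancl)
  qed
  have from0: "(0, v) \<in> ?R\<^sup>*" if "v < 2 * n" for v
    using A[of v] B[of "v - n"] that by (cases "v < n") auto
  have "sym (?R\<^sup>*)"
    using symR by (intro sym_rtrancl symI)
  then have "(u, v) \<in> ?R\<^sup>*" if "u < 2 * n" "v < 2 * n" for u v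
    using from0[OF that(1)] from0[OF that(2)] by (meson rtrancl_trans symD)
  then show ?thesis
    using assms unfolding connected_graph_def by (auto simp: lessThan_empty_iff)
qed

lemma not_bipartite_hub_graph:
  assumes "n \<ge> 2"
  shows "\<not> bipartite (hub_graph n)"
proof
  assume "bipartite (hub_graph n)"
  then obtain X Y where XY: "X \<inter> Y = {}"
    "\<forall>e\<in>edges (hub_graph n). \<exists>x\<in>X. \<exists>y\<in>Y. e = {x, y}"
    unfolding bipartite_def by (elim exE conjE)
  have sides: "u \<in> X \<and> v \<in> Y \<or> v \<in> X \<and> u \<in> Y" if "{u, v} \<in> edges (hub_graph n)" for u v
  proof -
    from bspec[OF XY(2) that] obtain x y where "x \<in> X" "y \<in> Y" "{u, v} = {x, y}"
      by (elim bexE)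
    then show ?thesis by (auto simp: doubleton_eq_iff)
  qed
  have "{0, n} \<in> edges (hub_graph n)" "{0, n + 1} \<in> edges (hub_graph n)"
    using hub_edge[of 0 0 n] hub_edge[of 0 1 n] assms by auto
  from this[THEN sides] sides[OF extra_edge[of n]] show False
    using XY(1) by (metis disjoint_iff)
qed

lemma matching_number_hub_graph:
  assumes "n \<ge> 2"
  shows "matching_number (hub_graph n) = n"
proof -
  let ?M = "(\<lambda>i. {i, n + i}) ` {..<n}"
  have card: "card ?M = n"
    by (subst card_image) (auto simp: inj_on_def doubleton_eq_iff)
  have "matching (hub_graph n) ?M"
    by (auto simp: matching_def pairwise_def disjnt_def matching_edge)
  then show ?thesis
    using matching_number_perfect[OF simple_hub_graph[OF assms]] card
    by (simp add: order_of_hub_graph)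
qed

lemma independent_lower_half:
  "independent_set (hub_graph n) {..<n}"
  by (auto simp: independent_set_def doubleton_eq_iff elim!: hub_graph_edge_cases)

text \<open>
  An independent set that meets \<open>B\<close> embeds into \<open>{1..<n}\<close> by sending \<open>a\<^sub>i\<close> and \<open>b\<^sub>i\<close> to \<open>i\<close>, except
  that \<open>b\<^sub>0\<close> goes to \<open>1\<close>. The value \<open>1\<close> is free for \<open>b\<^sub>0\<close> because the hub \<open>a\<^sub>1\<close> is excluded and
  \<open>b\<^sub>0 b\<^sub>1\<close> is an edge.
\<close>

lemma independent_set_hub_graph:
  assumes n: "n \<ge> 2" and ind: "independent_set (hub_graph n) S" and ne: "S \<noteq> {..<n}"
  shows "card S < n"
proof (cases "S \<subseteq> {..<n}")
  case True
  then have "card S < card {..<n}"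
    using ne by (intro psubset_card_mono) auto
  then show ?thesis by simp
next
  case False
  have sub: "S \<subseteq> {..<2 * n}" using ind by (simp add: independent_set_def)
  have nonadj: "{u, v} \<notin> edges (hub_graph n)" if "u \<in> S" "v \<in> S" for u v
    using ind that by (simp add: independent_set_def)
  obtain j where j: "n + j \<in> S" "j < n"
    using False sub by (metis add_less_cancel_left le_Suc_ex lessThan_iff linorder_not_le
        mult_2 subset_iff)
  have hubs: "i \<notin> S" if "i < 2" for i
    using nonadj[of i "n + j"] hub_edge[of i j n] that j by auto
  let ?f = "\<lambda>v. if v < n then v else max 1 (v - n)"
  have "inj_on ?f S"
  proof (rule inj_onI)
    fix u v assume uv: "u \<in> S" "v \<in> S" "?f u = ?f v"
    have pair: "\<not> (x \<in> S \<and> n + x \<in> S)" if "x < n" for x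
      using nonadj matching_edge[OF that] by blast
    have extra: "\<not> (n \<in> S \<and> n + 1 \<in> S)"
      using nonadj extra_edge by blast
    have cross: False if "x \<in> S" "y \<in> S" "x < n" "\<not> y < n" "?f x = ?f y" for x y
    proof -
      have "x \<ge> 2" using hubs that(1) by (meson not_le_imp_less)
      then have "y = n + x" using that by (auto simp: max_def split: if_splits)
      then show False using pair that by blast
    qed
    consider "u < n" "v < n" | "u < n" "\<not> v < n" | "\<not> u < n" "v < n" | "\<not> u < n" "\<not> v < n"
      by blast
    then show "u = v"
    proof cases
      case 1
      then show ?thesis using uv by simp
    next
      case 2
      then show ?thesis using cross uv by blast
    next
      case 3
      then show ?thesis using cross[of v u] uv by simp
    next
      case 4
      then have "u = v \<or> {u, v} = {n, n + 1}"
        using uv(3) by (auto simp: max_def doubleton_eq_iff split: if_splits)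
      then show ?thesis using extra uv by (auto simp: doubleton_eq_iff)
    qed
  qed
  moreover have "?f ` S \<subseteq> {1..<n}"
  proof (rule image_subsetI)
    fix v assume "v \<in> S"
    then have "v > 0" "v < 2 * n" using sub hubs[of 0] by (auto intro: gr0I)
    then show "?f v \<in> {1..<n}" using n by auto
  qed
  ultimately have "card S \<le> card {1..<n}"
    by (rule card_inj_on_le) simp
  then show ?thesis using n by simp
qed

lemma size_of_hub_graph:
  assumes "n \<ge> 2"
  shows "size_of (hub_graph n) = 3 * n - 1"
proof -
  let ?g = "\<lambda>(i, j). {i, n + j}"
  have inj: "inj_on ?g (hub_pairs n)"
    using assms by (auto simp: inj_on_def hub_pairs_iff doubleton_eq_iff)
  have fin: "finite (hub_pairs n)" by (simp add: hub_pairs_def)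
  have "card (hub_pairs n) = 2 * n + (n - 2)"
    unfolding hub_pairs_def
    by (subst card_Un_disjoint) (auto simp: card_image inj_on_def card_cartesian_product)
  moreover have "{n, n + 1} \<notin> ?g ` hub_pairs n"
    using assms by (auto simp: hub_pairs_iff doubleton_eq_iff)
  ultimately show ?thesis
    using assms fin by (simp add: size_of_def hub_graph_def card_image[OF inj])
qed

lemma vdeg_leaf:
  assumes "2 \<le> i" "i < n"
  shows "vdeg (hub_graph n) i \<le> 1"
proof -
  have "{e \<in> edges (hub_graph n). i \<in> e} \<subseteq> {{i, n + i}}"
    using assms by (auto elim!: hub_graph_edge_cases)
  then show ?thesis
    unfolding vdeg_def by (metis card_mono finite.emptyI finite.insertI is_singletonI
        is_singleton_altdef)
qed

lemma vdeg_upper_half_le: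
  assumes "j < n" "n \<ge> 2"
  shows "vdeg (hub_graph n) (n + j) \<le> 3"
proof -
  let ?c = "if j < 2 then {n, n + 1} else {j, n + j}"
  have "{e \<in> edges (hub_graph n). n + j \<in> e} \<subseteq> {{0, n + j}, {1, n + j}, ?c}"
  proof
    fix e assume "e \<in> {e \<in> edges (hub_graph n). n + j \<in> e}"
    then have e: "e \<in> edges (hub_graph n)" "n + j \<in> e" by auto
    from e(1) show "e \<in> {{0, n + j}, {1, n + j}, ?c}"
    proof (cases rule: hub_graph_edge_cases)
      case 1
      then have "j < 2" using e(2) by auto
      then show ?thesis using 1 by simp
    next
      case (2 i j')
      then have "e = {i, n + j}" "i = 0 \<or> i = 1" using e(2) assms by auto
      then show ?thesis by auto
    next
      case (3 i)
      then show ?thesis using e(2) assms by auto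
    qed
  qed
  then have "vdeg (hub_graph n) (n + j) \<le> card {{0, n + j}, {1, n + j}, ?c}"
    unfolding vdeg_def by (intro card_mono) auto
  also have "\<dots> \<le> 3"
    by (auto intro!: order_trans[OF card_insert_le_m1])
  finally show ?thesis .
qed

lemma vdeg_upper_half_ge:
  assumes "j < n" "n \<ge> 2"
  shows "vdeg (hub_graph n) (n + j) \<ge> 2"
proof -
  have "card {{0, n + j}, {1, n + j}} \<le> vdeg (hub_graph n) (n + j)"
    unfolding vdeg_def
    using assms finite_edges[OF simple_hub_graph[OF assms(2)]] hub_edge[of 0 j n] hub_edge[of 1 j n]
    by (intro card_mono) auto
  moreover have "{0, n + j} \<noteq> {1, n + j}" using assms by (auto simp: doubleton_eq_iff)
  ultimately show ?thesis by simp
qed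

text \<open>
  Trading the two hubs for three cheap vertices of \<open>B\<close> fits into the edge count precisely from
  \<open>n = 4\<close> on, where \<open>(n - 2) + 3 * 3 \<le> 3 * n - 1\<close>.
\<close>

lemma annihilation_number_hub_graph:
  assumes "n \<ge> 4"
  shows "annihilation_number (hub_graph n) > n"
proof -
  let ?D = "{2..<n} \<union> (+) n ` {..<3}"
  have card3: "card ((+) n ` {..<3}) = 3"
    by (simp add: card_image)
  have disj: "{2..<n} \<inter> (+) n ` {..<3} = {}" by auto
  have "set_deg (hub_graph n) ?D =
      (\<Sum>v\<in>{2..<n}. vdeg (hub_graph n) v) + (\<Sum>v\<in>(+) n ` {..<3}. vdeg (hub_graph n) v)"
    unfolding set_deg_def using disj by (intro sum.union_disjoint) auto
  also have "\<dots> \<le> card {2..<n} * 1 + card ((+) n ` {..<3}) * 3"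
    using vdeg_leaf vdeg_upper_half_le assms
    by (intro add_mono sum_bounded_above[where 'a=nat, simplified]) auto
  also have "\<dots> \<le> size_of (hub_graph n)"
    using assms card3 by (simp add: size_of_hub_graph)
  finally have "annihilating_set (hub_graph n) ?D"
    using assms by (auto simp: annihilating_set_def)
  then have "card ?D \<le> annihilation_number (hub_graph n)"
    by (intro card_le_annihilation_number) auto
  moreover have "card ?D = n + 1"
    using assms card3 disj by (subst card_Un_disjoint) auto
  ultimately show ?thesis by simp
qed

lemma maximal_annihilating_lower_half:
  assumes n: "n \<ge> 2"
  shows "maximal_annihilating_set (hub_graph n) {..<n}"
proof -
  let ?G = "hub_graph n"
  have fin: "finite (edges ?G)" by (rule finite_edges[OF simple_hub_graph[OF n]])
  \<comment> \<open>The only edge inside \<open>B\<close> is the extra one.\<close>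
  have "{e \<in> edges ?G. e \<inter> {..<n} \<noteq> {}} = edges ?G - {{n, n + 1}}"
  proof -
    have "e \<inter> {..<n} \<noteq> {} \<longleftrightarrow> e \<noteq> {n, n + 1}" if "e \<in> edges ?G" for e
      using that
    proof (cases rule: hub_graph_edge_cases)
      case (2 i j)
      then have "i \<in> e \<inter> {..<n}" using n by simp
      then show ?thesis by auto
    next
      case (3 i)
      then have "i \<in> e \<inter> {..<n}" by simp
      then show ?thesis by auto
    qed auto
    then show ?thesis by blast
  qed
  then have "set_deg ?G {..<n} = size_of ?G - 1"
    using set_deg_independent[OF simple_hub_graph[OF n] independent_lower_half]
      extra_edge[of n] fin by (simp add: size_of_def)
  moreover have "set_deg ?G ({..<n} \<union> {v}) \<ge> set_deg ?G {..<n} + 2"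
    if "v \<in> verts ?G - {..<n}" for v
  proof -
    have "v - n < n" "n + (v - n) = v" using that by auto
    then have "vdeg ?G v \<ge> 2" using vdeg_upper_half_ge n by metis
    then show ?thesis using that by (simp add: set_deg_def)
  qed
  ultimately show ?thesis
    unfolding maximal_annihilating_set_def annihilating_set_def
    using size_of_hub_graph[OF n] n by fastforce
qed

theorem theorem5p3:
  fixes k :: nat
  shows "\<exists>H :: nat ugraph.
    simple_graph H \<and> connected_graph H \<and> \<not> bipartite H \<and> konig_egervary H \<and>
    order_of H = 2 * k + 8 \<and>
    real (annihilation_number H) > real (order_of H) / 2 \<and>
    real (order_of H) / 2 = real (independence_number H) \<and>
    (\<forall>S\<in>maximum_independent_sets H. maximal_annihilating_set H S)"
proof -
  define n where "n = k + 4"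
  have n: "n \<ge> 2" "n \<ge> 4" by (auto simp: n_def)
  have "independence_number (hub_graph n) = n"
    and "maximum_independent_sets (hub_graph n) = {{..<n}}"
    using unique_maximum_independent_set[OF simple_hub_graph[OF n(1)] independent_lower_half]
      independent_set_hub_graph[OF n(1)] by auto
  moreover have "order_of (hub_graph n) = 2 * k + 8"
    by (simp add: order_of_hub_graph n_def)
  ultimately show ?thesis
    using simple_hub_graph[OF n(1)] connected_hub_graph[OF n(1)] not_bipartite_hub_graph[OF n(1)]
      matching_number_hub_graph[OF n(1)] annihilation_number_hub_graph[OF n(2)]
      maximal_annihilating_lower_half[OF n(1)]
    by (intro exI[of _ "hub_graph n"]) (auto simp: konig_egervary_def order_of_hub_graph n_def)
qed

end
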